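(* Let $\delta>0$, $\alpha\ge0$, $\beta\ge0$, $\gamma:=\alpha+2\beta-3$, and suppose that $-3<\gamma<0$. Let $u(t)$ be a solution, with forward maximal interval of existence $[0,\omega)$, of $$\ddot u+\delta\,\frac{|\dot u|^{\alpha}\,\dot u}{|u|^{\beta}}=-\frac{u}{|u|^3},\qquad u\in\mathbb R^2\setminus\{0\},$$ such that $e(t)\to0$ as $t\to\omega$. Then $\omega<\infty$.
   Context: With $L(u,\dot u)=u\wedge\dot u=u_1\dot u_2-u_2\dot u_1$ (identified with $(0,0,L)$), the eccentricity vector is $\mathcal E(u,\dot u)=\dot u\wedge L-\frac u{|u|}=L(\dot u_2,-\dot u_1)-\frac u{|u|}$, and $e(t)=|\mathcal E(u(t),\dot u(t))|$ is the eccentricity. A priori $\omega\in(0,\infty]$. *)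

theory Defs
  imports "HOL-Analysis.Analysis"
begin

definition forward_interval :: "ereal \<Rightarrow> real set" where
  "forward_interval \<omega> = {t. 0 \<le> t \<and> ereal t < \<omega>}"

text \<open>The acceleration prescribed by the equation at position \<open>x\<close> and velocity \<open>y\<close>.
  For \<open>\<alpha> = 0\<close> and \<open>y = 0\<close> the library convention \<open>0 powr 0 = 0\<close> differs from the usual
  value \<open>1\<close>, but this factor is multiplied by \<open>y = 0\<close>, so the drag term is \<open>0\<close> either way.\<close>

definition kepler_drag_accel :: "real \<Rightarrow> real \<Rightarrow> real \<Rightarrow> real^2 \<Rightarrow> real^2 \<Rightarrow> real^2" where
  "kepler_drag_accel \<delta> \<alpha> \<beta> x y =
     - (1 / norm x ^ 3) *\<^sub>R x - (\<delta> * norm y powr \<alpha> / norm x powr \<beta>) *\<^sub>R y"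

text \<open>\<open>v\<close> is the velocity of \<open>u\<close>, hence determined by \<open>u\<close> on the interval; derivatives at
  time \<open>0\<close> are one-sided.\<close>

definition kepler_drag_solution ::
  "real \<Rightarrow> real \<Rightarrow> real \<Rightarrow> ereal \<Rightarrow> (real \<Rightarrow> real^2) \<Rightarrow> (real \<Rightarrow> real^2) \<Rightarrow> bool" where
  "kepler_drag_solution \<delta> \<alpha> \<beta> \<omega> u v \<longleftrightarrow>
     (\<forall>t \<in> forward_interval \<omega>. u t \<noteq> 0 \<and>
        (u has_vector_derivative v t) (at t within forward_interval \<omega>) \<and>
        (v has_vector_derivative kepler_drag_accel \<delta> \<alpha> \<beta> (u t) (v t))
          (at t within forward_interval \<omega>))"

definition forward_maximal_solution ::
  "real \<Rightarrow> real \<Rightarrow> real \<Rightarrow> ereal \<Rightarrow> (real \<Rightarrow> real^2) \<Rightarrow> (real \<Rightarrow> real^2) \<Rightarrow> bool" where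
  "forward_maximal_solution \<delta> \<alpha> \<beta> \<omega> u v \<longleftrightarrow>
     0 < \<omega> \<and> kepler_drag_solution \<delta> \<alpha> \<beta> \<omega> u v \<and>
     \<not> (\<exists>\<omega>' u' v'. \<omega> < \<omega>' \<and> kepler_drag_solution \<delta> \<alpha> \<beta> \<omega>' u' v' \<and>
          (\<forall>t \<in> forward_interval \<omega>. u' t = u t))"

definition ang_mom :: "real^2 \<Rightarrow> real^2 \<Rightarrow> real" where
  "ang_mom x y = x $ 1 * y $ 2 - x $ 2 * y $ 1"

definition ecc_vec :: "real^2 \<Rightarrow> real^2 \<Rightarrow> real^2" where
  "ecc_vec x y = ang_mom x y *\<^sub>R vector [y $ 2, - (y $ 1)] - (1 / norm x) *\<^sub>R x"

definition eccentricity :: "real^2 \<Rightarrow> real^2 \<Rightarrow> real" where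
  "eccentricity x y = norm (ecc_vec x y)"

end

theory Submission
  imports Defs
begin

text \<open>
  Along a nearly circular orbit the angular momentum \<open>L\<close> controls everything: small eccentricity
  forces \<open>|u| \<approx> L\<^sup>2\<close> and \<open>|v| \<approx> 1 / |L|\<close> (lemmas \<open>ang_mom_sq_near_norm\<close> and
  \<open>ang_mom_speed_near_one\<close>). The central force exerts no torque, so the drag alone changes \<open>L\<close>, at
  the relative rate \<open>- \<delta> |v|\<^sup>\<alpha> / |u|\<^sup>\<beta>\<close> (\<open>has_derivative_ang_mom\<close>), and this rate is comparable to
  \<open>- \<delta> |L|\<^sup>-\<^sup>p\<close> with \<open>p = \<alpha> + 2\<beta> = \<gamma> + 3 > 0\<close> (\<open>drag_rate_lower_bound\<close>). Therefore the derivative of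
  \<open>|L|\<^sup>p\<close> stays below a negative constant once the eccentricity is at most \<open>1/2\<close>, whereas \<open>|L|\<^sup>p\<close> is
  never negative. So the orbit cannot remain nearly circular for an infinite time.
\<close>

lemma norm_sq_vec2: "(norm (x :: real^2))\<^sup>2 = (x $ 1)\<^sup>2 + (x $ 2)\<^sup>2"
  unfolding power2_norm_eq_inner by (simp add: inner_vec_def sum_2 power2_eq_square)

lemma inner_ecc_vec_position:
  assumes "x \<noteq> 0"
  shows "ecc_vec x y \<bullet> x = (ang_mom x y)\<^sup>2 - norm x"
proof -
  have "x \<bullet> x = norm x * norm x"
    by (simp add: power2_norm_eq_inner[symmetric] power2_eq_square)
  moreover have "vector [y $ 2, - (y $ 1)] \<bullet> x = ang_mom x y"
    by (simp add: inner_vec_def sum_2 ang_mom_def algebra_simps)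
  ultimately show ?thesis
    using assms by (simp add: ecc_vec_def inner_diff_left power2_eq_square)
qed

text \<open>This is the orbit equation \<open>|u| + \<E> \<bullet> u = L\<^sup>2\<close>, with \<open>\<E> \<bullet> u\<close> estimated by Cauchy--Schwarz.\<close>

lemma ang_mom_sq_near_norm:
  assumes "x \<noteq> 0"
  shows "\<bar>(ang_mom x y)\<^sup>2 - norm x\<bar> \<le> eccentricity x y * norm x"
  using Cauchy_Schwarz_ineq2[of "ecc_vec x y" x]
  by (simp add: inner_ecc_vec_position[OF assms] eccentricity_def)

text \<open>The eccentricity vector is the difference of a vector of length \<open>|L| |v|\<close> and a unit vector.\<close>

lemma ang_mom_speed_near_one:
  assumes "x \<noteq> 0"
  shows "\<bar>\<bar>ang_mom x y\<bar> * norm y - 1\<bar> \<le> eccentricity x y"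
proof -
  have "(norm (vector [y $ 2, - (y $ 1)] :: real^2))\<^sup>2 = (norm y)\<^sup>2"
    by (simp add: norm_sq_vec2)
  then have "norm (vector [y $ 2, - (y $ 1)] :: real^2) = norm y"
    by (simp add: power2_eq_iff_nonneg)
  then show ?thesis
    using norm_triangle_ineq3[of "ang_mom x y *\<^sub>R vector [y $ 2, - (y $ 1)]" "(1 / norm x) *\<^sub>R x"] assms
    by (simp add: eccentricity_def ecc_vec_def)
qed

lemma ang_mom_nonzero:
  assumes "x \<noteq> 0" and "eccentricity x y < 1"
  shows "ang_mom x y \<noteq> 0"
  using ang_mom_speed_near_one[OF assms(1), of y] assms(2) by auto

text \<open>In the estimates \<open>|L| |v| \<approx> 1\<close> and \<open>|u| \<approx> L\<^sup>2\<close> the powers of \<open>|L|\<close> are chosen so as to cancel;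
  what is left are powers of \<open>|L| |v|\<close> and \<open>L\<^sup>2 / |u|\<close>, both of which are at least \<open>1/2\<close>.\<close>

lemma drag_rate_lower_bound:
  fixes \<alpha> \<beta> :: real
  assumes "x \<noteq> 0" and "eccentricity x y \<le> 1/2" and "\<alpha> \<ge> 0" and "\<beta> \<ge> 0"
  shows "(1/2) powr (\<alpha> + \<beta>)
    \<le> ((ang_mom x y)\<^sup>2) powr ((\<alpha> + 2 * \<beta>) / 2) * (norm y powr \<alpha> / norm x powr \<beta>)"
proof -
  define L where "L = \<bar>ang_mom x y\<bar>"
  have L: "L > 0"
    using ang_mom_nonzero[OF assms(1), of y] assms(2) by (simp add: L_def)
  have x: "norm x > 0"
    using assms(1) by simp
  have speed: "1/2 \<le> L * norm y"
    using ang_mom_speed_near_one[OF assms(1), of y] assms(2) unfolding L_def by linarith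
  have "eccentricity x y * norm x \<le> 1/2 * norm x"
    using assms(2) x by (intro mult_right_mono) auto
  then have "norm x / 2 \<le> L\<^sup>2"
    using ang_mom_sq_near_norm[OF assms(1), of y] by (simp add: L_def)
  then have radius: "1/2 \<le> L\<^sup>2 / norm x"
    using x by (simp add: field_simps)
  have L2: "(L\<^sup>2) powr s = L powr (2 * s)" for s
    using L by (simp add: powr_powr flip: powr_numeral)
  have "(1/2) powr (\<alpha> + \<beta>) = (1/2) powr \<alpha> * (1/2) powr \<beta>"
    by (simp add: powr_add)
  also have "\<dots> \<le> (L * norm y) powr \<alpha> * (L\<^sup>2 / norm x) powr \<beta>"
    using speed radius assms(3,4) by (intro mult_mono powr_mono2) auto
  also have "\<dots> = (L powr \<alpha> * L powr (2 * \<beta>)) * (norm y powr \<alpha> / norm x powr \<beta>)"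
    using L by (simp add: powr_mult powr_divide L2)
  also have "L powr \<alpha> * L powr (2 * \<beta>) = (L\<^sup>2) powr ((\<alpha> + 2 * \<beta>) / 2)"
    by (simp add: L2 add_divide_distrib flip: powr_add)
  finally show ?thesis
    by (simp add: L_def)
qed

lemma has_derivative_ang_mom:
  fixes u v :: "real \<Rightarrow> real^2"
  assumes "(u has_vector_derivative v t) (at t within S)"
    and "(v has_vector_derivative kepler_drag_accel \<delta> \<alpha> \<beta> (u t) (v t)) (at t within S)"
  shows "((\<lambda>s. ang_mom (u s) (v s)) has_real_derivative
    - \<delta> * (norm (v t) powr \<alpha> / norm (u t) powr \<beta>) * ang_mom (u t) (v t)) (at t within S)"
proof -
  have comp: "((\<lambda>s. f s $ i) has_real_derivative f' $ i) (at t within S)"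
    if "(f has_vector_derivative f') (at t within S)" for f :: "real \<Rightarrow> real^2" and f' i
    using bounded_linear.has_vector_derivative[OF bounded_linear_vec_nth that]
    by (simp add: has_real_derivative_iff_has_vector_derivative)
  note deriv = comp[OF assms(1)] comp[OF assms(2)]
  show ?thesis
    unfolding ang_mom_def
    by (rule derivative_eq_intros deriv refl)+
       (simp add: kepler_drag_accel_def algebra_simps)
qed

text \<open>Multiplying \<open>L' / L\<close> by \<open>p |L|\<^sup>p\<close> turns the bound on the drag rate into one on the derivative of
  \<open>|L|\<^sup>p\<close> in which \<open>L\<close> does not occur; so \<open>|L|\<^sup>p\<close> would become negative in finite time.\<close>

lemma no_global_solution_with_small_eccentricity:
  fixes u v :: "real \<Rightarrow> real^2"
  assumes "\<delta> > 0" and "\<alpha> \<ge> 0" and "\<beta> \<ge> 0" and "\<alpha> + 2 * \<beta> > 0"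
    and sol: "kepler_drag_solution \<delta> \<alpha> \<beta> \<infinity> u v"
    and "T > 0" and ecc: "\<And>t. t \<ge> T \<Longrightarrow> eccentricity (u t) (v t) \<le> 1/2"
  shows False
proof -
  define p where "p = \<alpha> + 2 * \<beta>"
  define c where "c = p * \<delta> * (1/2) powr (\<alpha> + \<beta>)"
  \<comment> \<open>\<open>F = |L|\<^sup>p\<close>, written as a power of the smooth quantity \<open>L\<^sup>2\<close>.\<close>
  define F where "F t = ((ang_mom (u t) (v t))\<^sup>2) powr (p / 2)" for t
  have "c > 0"
    using assms(1,4) by (simp add: c_def p_def)
  have decay: "\<exists>d. ((\<lambda>s. F s + c * s) has_real_derivative d) (at t) \<and> d \<le> 0" if "t \<ge> T" for t
  proof -
    let ?k = "norm (v t) powr \<alpha> / norm (u t) powr \<beta>"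
    let ?L = "ang_mom (u t) (v t)"
    have int: "forward_interval \<infinity> = {0..}"
      by (auto simp: forward_interval_def)
    have "at t within {0..} = at t"
      using that \<open>T > 0\<close> by (intro at_within_interior) simp
    moreover have "t \<in> {0..}"
      using that \<open>T > 0\<close> by simp
    ultimately have ut: "u t \<noteq> 0" and du: "(u has_vector_derivative v t) (at t)"
      and dv: "(v has_vector_derivative kepler_drag_accel \<delta> \<alpha> \<beta> (u t) (v t)) (at t)"
      using sol unfolding kepler_drag_solution_def int by metis+
    have L: "?L\<^sup>2 > 0"
      using ang_mom_nonzero[OF ut] ecc[OF that] by auto
    have "((\<lambda>s. (ang_mom (u s) (v s))\<^sup>2) has_real_derivative - 2 * \<delta> * ?k * ?L\<^sup>2) (at t)"
      by (rule derivative_eq_intros has_derivative_ang_mom[OF du dv] refl)+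
         (simp add: power2_eq_square)
    from DERIV_chain2[where f = "\<lambda>z. z powr (p / 2)", OF has_real_derivative_powr[OF L] this]
    have "(F has_real_derivative (p / 2 * ?L\<^sup>2 powr (p / 2 - 1)) * (- 2 * \<delta> * ?k * ?L\<^sup>2)) (at t)"
      by (simp add: F_def[abs_def])
    also have "(p / 2 * ?L\<^sup>2 powr (p / 2 - 1)) * (- 2 * \<delta> * ?k * ?L\<^sup>2)
        = - (p * \<delta>) * (F t * ?k)"
      using L by (simp add: F_def powr_diff)
    finally have dF: "(F has_real_derivative - (p * \<delta>) * (F t * ?k)) (at t)" .
    have "((\<lambda>s. F s + c * s) has_real_derivative - (p * \<delta>) * (F t * ?k) + c) (at t)"
      by (rule derivative_eq_intros dF refl)+ simp
    moreover have "c \<le> p * \<delta> * (F t * ?k)"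
      unfolding c_def F_def p_def using assms(1,4)
      by (intro mult_left_mono drag_rate_lower_bound ut ecc that assms(2,3)) auto
    ultimately show ?thesis
      by (intro exI[of _ "- (p * \<delta>) * (F t * ?k) + c"]) auto
  qed
  \<comment> \<open>A time past which the linear upper bound for \<open>F\<close> is negative.\<close>
  define T' where "T' = T + (F T + 1) / c"
  have F_nonneg: "F t \<ge> 0" for t
    by (simp add: F_def)
  have "T \<le> T'"
    using \<open>c > 0\<close> F_nonneg[of T] by (simp add: T'_def)
  then have "F T' + c * T' \<le> F T + c * T"
    using decay by (intro DERIV_nonpos_imp_nonincreasing[of T T' "\<lambda>s. F s + c * s"]) auto
  moreover have "c * T' = c * T + F T + 1"
    using \<open>c > 0\<close> by (simp add: T'_def field_simps)
  ultimately show False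
    using F_nonneg[of T'] by linarith
qed

theorem lemma6p6:
  fixes \<delta> \<alpha> \<beta> \<gamma> :: real and \<omega> :: ereal and u v :: "real \<Rightarrow> real^2"
  assumes "\<delta> > 0" and "\<alpha> \<ge> 0" and "\<beta> \<ge> 0"
    and "\<gamma> = \<alpha> + 2 * \<beta> - 3" and "-3 < \<gamma>" and "\<gamma> < 0"
    and "forward_maximal_solution \<delta> \<alpha> \<beta> \<omega> u v"
    and "((\<lambda>t. eccentricity (u (real_of_ereal t)) (v (real_of_ereal t))) \<longlongrightarrow> 0) (at_left \<omega>)"
  shows "\<omega> < \<infinity>"
proof (rule ccontr)
  assume "\<not> \<omega> < \<infinity>"
  then have inf: "\<omega> = \<infinity>"
    by simp
  have "((\<lambda>t. eccentricity (u t) (v t)) \<longlongrightarrow> 0) at_top"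
    using assms(8) by (simp add: inf at_left_PInf filterlim_filtermap)
  then have "eventually (\<lambda>t. eccentricity (u t) (v t) < 1/2) at_top"
    by (rule order_tendstoD) simp
  then obtain N where N: "\<And>t. t \<ge> N \<Longrightarrow> eccentricity (u t) (v t) < 1/2"
    by (auto simp: eventually_at_top_linorder)
  have "kepler_drag_solution \<delta> \<alpha> \<beta> \<infinity> u v"
    using assms(7) by (simp add: forward_maximal_solution_def inf)
  moreover have "\<alpha> + 2 * \<beta> > 0"
    using assms(4,5) by simp
  moreover have "max N 1 > 0"
    by simp
  ultimately show False
    using no_global_solution_with_small_eccentricity[of \<delta> \<alpha> \<beta> u v "max N 1"] assms(1-3) N
    by (meson less_imp_le max.boundedE)
qed

end
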